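(* Let $\Delta t,\Delta x>0$, and consider the following time-discrete scheme for the moments and the electric field of the Vlasov-Ampère system, posed with periodic boundary condition in $x$: $$E^{n+1}=E^n+\Delta t\,(\rho u)^n,$$ $$\begin{cases}\dfrac{\rho^{n+1}-\rho^n}{\Delta t}+\nabla_x\cdot\displaystyle\int_{\mathbb R^d}v f^n\,dv=0,\\[8pt] \dfrac{(\rho u)^{n+1}-(\rho u)^n}{\Delta t}+\nabla_x\cdot\displaystyle\int_{\mathbb R^d}v\otimes v f^n\,dv+E^n\rho^n=0,\\[8pt] \dfrac{E_{\mathrm{Kin}}^{n+1}-E_{\mathrm{Kin}}^n}{\Delta t}+\nabla_x\cdot\displaystyle\int_{\mathbb R^d}\frac{|v|^2}{2}v f^n\,dv+\frac{E^n+E^{n+1}}{2}\cdot(\rho u)^n=0.\end{cases}$$ Let $(\rho,u,E_{\mathrm{Kin}},E)_i$ be the numerical approximation of the corresponding quantities at the grid point $x_i$, $i=0,\dots,N_x$. If the divergence terms in the moment system are discretized by a conservative spatial discretization (all other terms being evaluated pointwise at $x_i$), then the total mass and the total energy are conserved: $$\sum_{i=0}^{N_x}\rho_i^{n+1}=\sum_{i=0}^{N_x}\rho_i^n,\qquad \sum_{i=0}^{N_x}\Big((E_{\mathrm{Kin}}^{n+1})_i+\tfrac12(E_i^{n+1})^2\Big)=\sum_{i=0}^{N_x}\Big((E_{\mathrm{Kin}}^{n})_i+\tfrac12(E_i^{n})^2\Big).$$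
   Context: The Vlasov-Ampère system is $\partial_tf+v\cdot\nabla_xf-E\cdot\nabla_vf=0$, $\partial_tE=\rho u$, where $f=f(t,x,v)$ is the particle density distribution, $E$ is the electric field, and the moments are $\rho=\int f\,dv$, $\rho u=\int vf\,dv$, $E_{\mathrm{Kin}}=\int\frac12|v|^2f\,dv$. In the scheme, $\rho^n,(\rho u)^n,E_{\mathrm{Kin}}^n,E^n$ are the quantities advanced by the displayed equations, and $f^n$ is a given numerical distribution at time $t_n$ (obtained from a separate discretization of the kinetic equation), entering only through the fluxes. The space grid is one-dimensional and uniform: points $x_i$, $i=0,\dots,N_x$, with spacing $\Delta x$. $(E_i)^2$ means $E_i\cdot E_i$. A conservative spatial discretization of a divergence term at $x_i$ means that it is replaced by $\frac{H_{i+\frac12}^n-H_{i-\frac12}^n}{\Delta x}$ for some numerical fluxes $H^n_{i+\frac12}$ (one family for each of the moment equations). Periodic boundary condition means that these fluxes satisfy $H^n_{N_x+\frac12}=H^n_{-\frac12}$. *)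

theory Defs
  imports "HOL-Analysis.Analysis"
begin

text \<open>
  A numerical phase-space distribution at a fixed time: \<open>g i v\<close> approximates \<open>f(x\<^sub>i, v)\<close> at the
  grid points \<open>i = 0, \<dots>, N\<^sub>x\<close>; velocity stays continuous in \<open>\<real>\<^sup>d\<close>, with \<open>d = CARD('d)\<close>.
\<close>

type_synonym 'd grid_distribution = "nat \<Rightarrow> real ^ 'd \<Rightarrow> real"

text \<open>
  \<open>D g i\<close> is the value at \<open>x\<^sub>i\<close> of a discretized divergence term built from the distribution \<open>g\<close>.
  The numerical fluxes \<open>H g\<close> live at the half-integer points, so they are indexed by reals of which
  only \<open>-1/2, 1/2, \<dots>, N\<^sub>x + 1/2\<close> matter. They may depend on \<open>g\<close> in any way (in particular they
  need not factor through velocity moments of \<open>g\<close>), and conservativity does not include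
  consistency with the exact flux.
\<close>

definition conservative_periodic_discretization ::
  "nat \<Rightarrow> real \<Rightarrow> ('d::finite grid_distribution \<Rightarrow> nat \<Rightarrow> 'b::real_vector) \<Rightarrow> bool" where
  "conservative_periodic_discretization Nx dx D \<longleftrightarrow>
     (\<exists>H :: 'd grid_distribution \<Rightarrow> real \<Rightarrow> 'b. \<forall>g.
        (\<forall>i\<le>Nx. D g i = (H g (real i + 1/2) - H g (real i - 1/2)) /\<^sub>R dx) \<and>
        H g (real Nx + 1/2) = H g (- 1/2))"

end

theory Submission
  imports Defs
begin

text \<open>
  Two mechanisms are at work. In space, a conservative divergence is a difference of fluxes, so it
  telescopes over the grid, and periodicity makes the two remaining boundary fluxes cancel
  (\<open>sum_conservative_periodic_discretization\<close>); hence the transport terms do not contribute to any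
  total. In time, the electric field in the energy equation is evaluated at the midpoint
  \<open>(E\<^sup>n + E\<^sup>n\<^sup>+\<^sup>1)/2\<close>. Since \<open>\<Delta>t (\<rho>u)\<^sup>n = E\<^sup>n\<^sup>+\<^sup>1 - E\<^sup>n\<close> by the Ampere equation, the work term
  \<open>\<Delta>t (E\<^sup>n + E\<^sup>n\<^sup>+\<^sup>1)/2 \<bullet> (\<rho>u)\<^sup>n\<close> is the difference of squares \<open>(|E\<^sup>n\<^sup>+\<^sup>1|\<^sup>2 - |E\<^sup>n|\<^sup>2)/2\<close>: at every
  grid point, the kinetic energy lost to the field is exactly the electric energy gained. Mass and
  total energy therefore both obey a discrete conservation law without source
  (\<open>total_preserved_by_conservative_update\<close>).
\<close>

lemma sum_conservative_periodic_discretization: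
  fixes D :: "'d::finite grid_distribution \<Rightarrow> nat \<Rightarrow> 'b::real_vector"
  assumes "conservative_periodic_discretization Nx dx D"
  shows "(\<Sum>i=0..Nx. D g i) = 0"
proof -
  obtain H :: "'d grid_distribution \<Rightarrow> real \<Rightarrow> 'b"
    where D: "\<And>i. i \<le> Nx \<Longrightarrow> D g i = (H g (real i + 1/2) - H g (real i - 1/2)) /\<^sub>R dx"
      and periodic: "H g (real Nx + 1/2) = H g (- 1/2)"
    using assms unfolding conservative_periodic_discretization_def by blast
  \<comment> \<open>Indexing each flux by the grid point to its right makes consecutive differences telescope.\<close>
  define K where "K i = H g (real i - 1/2)" for i :: nat
  have K_Suc: "H g (real i + 1/2) = K (Suc i)" for i
    unfolding K_def by (rule arg_cong[where f = "H g"]) simp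
  have "(\<Sum>i=0..Nx. D g i) = (\<Sum>i=0..Nx. K (Suc i) - K i) /\<^sub>R dx"
    unfolding scaleR_sum_right by (rule sum.cong) (auto simp: D K_Suc K_def)
  also have "(\<Sum>i=0..Nx. K (Suc i) - K i) = K (Suc Nx) - K 0"
    by (rule sum_Suc_diff) simp
  also have "\<dots> = 0"
    using periodic by (simp add: K_Suc[symmetric]) (simp add: K_def)
  finally show ?thesis by simp
qed

lemma total_preserved_by_conservative_update:
  fixes a b :: "nat \<Rightarrow> 'b::real_vector"
  assumes "conservative_periodic_discretization Nx dx D"
    and update: "\<And>i. i \<le> Nx \<Longrightarrow> b i = a i - dt *\<^sub>R D g i"
  shows "(\<Sum>i=0..Nx. b i) = (\<Sum>i=0..Nx. a i)"
proof -
  have "(\<Sum>i=0..Nx. b i) = (\<Sum>i=0..Nx. a i - dt *\<^sub>R D g i)"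
    by (rule sum.cong) (auto simp: update)
  also have "\<dots> = (\<Sum>i=0..Nx. a i) - dt *\<^sub>R (\<Sum>i=0..Nx. D g i)"
    by (simp add: sum_subtractf scaleR_sum_right)
  finally show ?thesis
    by (simp add: sum_conservative_periodic_discretization[OF assms(1)])
qed

text \<open>
  The polarization identity \<open>(x + y) \<bullet> (y - x) = y \<bullet> y - x \<bullet> x\<close> with \<open>y = x + t *\<^sub>R j\<close>. It is exact for
  every step size, which is what the midpoint achieves: evaluating the field at either end of the
  step would leave an error of size \<open>t\<^sup>2 (j \<bullet> j) / 2\<close>.
\<close>

lemma midpoint_work_eq_field_energy_increment:
  fixes x y j :: "'a::real_inner"
  assumes "y = x + t *\<^sub>R j"
  shows "t * (((x + y) /\<^sub>R 2) \<bullet> j) = 1/2 * (y \<bullet> y) - 1/2 * (x \<bullet> x)"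
  unfolding assms by (simp add: inner_simps inner_commute[of j x] algebra_simps)

theorem theorem7p1:
  fixes Nx n :: nat and dt dx :: real
    and f :: "nat \<Rightarrow> 'd::finite grid_distribution"
    and rho EKin :: "nat \<Rightarrow> nat \<Rightarrow> real"
    and rhou E :: "nat \<Rightarrow> nat \<Rightarrow> real ^ 'd"
    and div_mass div_energy :: "'d grid_distribution \<Rightarrow> nat \<Rightarrow> real"
    and div_momentum :: "'d grid_distribution \<Rightarrow> nat \<Rightarrow> real ^ 'd"
  assumes "dt > 0" and "dx > 0"
    and "conservative_periodic_discretization Nx dx div_mass"
    and "conservative_periodic_discretization Nx dx div_momentum"
    and "conservative_periodic_discretization Nx dx div_energy"
    and ampere: "\<And>i. i \<le> Nx \<Longrightarrow> E (n + 1) i = E n i + dt *\<^sub>R rhou n i"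
    and mass: "\<And>i. i \<le> Nx \<Longrightarrow>
      (rho (n + 1) i - rho n i) / dt + div_mass (f n) i = 0"
    and momentum: "\<And>i. i \<le> Nx \<Longrightarrow>
      (rhou (n + 1) i - rhou n i) /\<^sub>R dt + div_momentum (f n) i + rho n i *\<^sub>R E n i = 0"
    and energy: "\<And>i. i \<le> Nx \<Longrightarrow>
      (EKin (n + 1) i - EKin n i) / dt + div_energy (f n) i
        + ((E n i + E (n + 1) i) /\<^sub>R 2) \<bullet> rhou n i = 0"
  shows "(\<Sum>i=0..Nx. rho (n + 1) i) = (\<Sum>i=0..Nx. rho n i) \<and>
    (\<Sum>i=0..Nx. EKin (n + 1) i + 1/2 * (E (n + 1) i \<bullet> E (n + 1) i))
      = (\<Sum>i=0..Nx. EKin n i + 1/2 * (E n i \<bullet> E n i))"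
proof
  show "(\<Sum>i=0..Nx. rho (n + 1) i) = (\<Sum>i=0..Nx. rho n i)"
  proof (rule total_preserved_by_conservative_update[OF assms(3)])
    fix i assume "i \<le> Nx"
    from mass[OF this] \<open>dt > 0\<close> show "rho (n + 1) i = rho n i - dt *\<^sub>R div_mass (f n) i"
      by (simp add: field_simps)
  qed
next
  show "(\<Sum>i=0..Nx. EKin (n + 1) i + 1/2 * (E (n + 1) i \<bullet> E (n + 1) i))
      = (\<Sum>i=0..Nx. EKin n i + 1/2 * (E n i \<bullet> E n i))"
  proof (rule total_preserved_by_conservative_update[OF assms(5)])
    fix i assume i: "i \<le> Nx"
    let ?work = "((E n i + E (n + 1) i) /\<^sub>R 2) \<bullet> rhou n i"
    have "(EKin (n + 1) i - EKin n i) / dt = - (div_energy (f n) i + ?work)"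
      using energy[OF i] by linarith
    then have "EKin (n + 1) i - EKin n i = - (div_energy (f n) i + ?work) * dt"
      using \<open>dt > 0\<close> by (simp only: divide_eq_eq split: if_splits)
    then have "EKin (n + 1) i - EKin n i = - (dt * div_energy (f n) i) - dt * ?work"
      by (simp only: minus_add_distrib distrib_left diff_conv_add_uminus mult_minus_right mult.commute[of _ dt])
    with midpoint_work_eq_field_energy_increment[OF ampere[OF i]]
    show "EKin (n + 1) i + 1/2 * (E (n + 1) i \<bullet> E (n + 1) i)
        = EKin n i + 1/2 * (E n i \<bullet> E n i) - dt *\<^sub>R div_energy (f n) i"
      unfolding real_scaleR_def by linarith
  qed
qed

end
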